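(* Let $\mathcal{G}$ be a finite, connected, simple graph with edge set $\mathcal{E}$, all of whose vertices have degree at least two, regarded as an equilateral quantum graph with every edge identified with $[0,1]$, and let $\mathcal{L}=-d^2/dx^2$ be the Laplacian with Kirchhoff vertex conditions (defined in the context). For $j=1,2$, assume that $y_j$ is an eigenfunction of $\mathcal{L}$ with the common eigenvalue $\lambda>0$, and put $\omega=\sqrt{\lambda}$. If $y_j(x) = A_{e,j}\cos(\omega x)+B_{e,j}\sin(\omega x)$ on each edge $e\cong[0,1]$, with $A_{e,j},B_{e,j}\in\mathbb{C}$, then \[ \int_{\mathcal{G}} y_1\overline{y_2} = \sum_{e\in\mathcal{E}}\frac12\bigl[A_{e,1}\overline{A_{e,2}} + B_{e,1}\overline{B_{e,2}}\bigr]. \]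
   Context: Equilateral quantum graph: each edge of $\mathcal{G}$ is given an orientation and identified with the interval $[0,1]$, the endpoints $0,1$ corresponding to the two vertices of the edge. A function $f$ on $\mathcal{G}$ is a collection of components $f_e:[0,1]\to\mathbb{C}$, $e\in\mathcal{E}$. The Hilbert space is $L^2(\mathcal{G})=\bigoplus_{e\in\mathcal{E}}L^2[0,1]$ with inner product $\int_{\mathcal{G}} f\overline{g} = \sum_{e\in\mathcal{E}}\int_0^1 f_e(x)\overline{g_e(x)}\,dx$. The operator $\mathcal{L}$ acts by $\mathcal{L}f=-f''$ on each edge. Its domain consists of the functions that are sufficiently differentiable on each edge (components in the Sobolev space $H^2[0,1]$), continuous on $\mathcal{G}$ (edge components agree at common vertices), and satisfy at each vertex $v$ the Kirchhoff condition: the sum over the edges $e$ incident on $v$ of the derivatives of $f_e$ at $v$, taken with respect to local coordinates in which $v$ corresponds to $0$ (i.e. pointing from $v$ into the edge), is zero. $\mathcal{L}$ is self-adjoint on $L^2(\mathcal{G})$. *)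

theory Defs
  imports
    "HOL-Analysis.Analysis"
    "Graph_Theory.Digraph_Component"
begin

text \<open>
  A simple undirected graph together with an orientation of its edges is a finite loop-free digraph
  in which distinct arcs have distinct (unordered) end-point sets; this excludes parallel as well
  as antiparallel arcs. The arc \<open>e\<close> is identified with \<open>[0,1]\<close>, where \<open>tail G e\<close> corresponds to
  \<open>0\<close> and \<open>head G e\<close> to \<open>1\<close>.
\<close>

definition oriented_simple_graph :: "('v, 'e) pre_digraph \<Rightarrow> bool" where
  "oriented_simple_graph G \<longleftrightarrow>
     digraph G \<and> inj_on (\<lambda>e. {tail G e, head G e}) (arcs G)"

definition incident_edges :: "('v, 'e) pre_digraph \<Rightarrow> 'v \<Rightarrow> 'e set" where
  "incident_edges G v = {e \<in> arcs G. tail G e = v \<or> head G e = v}"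

definition vertex_degree :: "('v, 'e) pre_digraph \<Rightarrow> 'v \<Rightarrow> nat" where
  "vertex_degree G v = card (incident_edges G v)"

text \<open>
  A function on the quantum graph is a family \<open>f e :: real \<Rightarrow> complex\<close> of which only the values
  for \<open>e \<in> arcs G\<close> on \<open>[0,1]\<close> matter.
\<close>

type_synonym 'e qg_fun = "'e \<Rightarrow> real \<Rightarrow> complex"

definition qg_inner :: "('v, 'e) pre_digraph \<Rightarrow> 'e qg_fun \<Rightarrow> 'e qg_fun \<Rightarrow> complex" where
  "qg_inner G f g =
     (\<Sum>e\<in>arcs G. LINT x|lebesgue_on {0..1}. f e x * cnj (g e x))"

definition L2_unit :: "(real \<Rightarrow> complex) set" where
  "L2_unit = {f. f \<in> borel_measurable (lebesgue_on {0..1}) \<and>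
                 integrable (lebesgue_on {0..1}) (\<lambda>x. (norm (f x))\<^sup>2)}"

text \<open>
  Elements of \<open>H\<^sup>k[0,1]\<close> are represented by their continuous representatives: \<open>f\<close> is
  absolutely continuous on \<open>[0,1]\<close> with derivative \<open>g \<in> L\<^sup>2[0,1]\<close>. In \<open>H2_unit\<close> the function \<open>g\<close>
  is itself continuous, so that \<open>f\<close> is continuously differentiable on \<open>[0,1]\<close> with
  derivative \<open>g\<close> (one-sided at the end points).
\<close>

definition has_L2_derivative :: "(real \<Rightarrow> complex) \<Rightarrow> (real \<Rightarrow> complex) \<Rightarrow> bool" where
  "has_L2_derivative f g \<longleftrightarrow>
     g \<in> L2_unit \<and> (\<forall>x\<in>{0..1}. f x = f 0 + (LINT t|lebesgue_on {0..x}. g t))"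

definition H2_unit :: "(real \<Rightarrow> complex) set" where
  "H2_unit = {f. \<exists>g h. has_L2_derivative f g \<and> has_L2_derivative g h}"

definition edge_deriv :: "(real \<Rightarrow> complex) \<Rightarrow> real \<Rightarrow> complex" where
  "edge_deriv f x = vector_derivative f (at x within {0..1})"

text \<open>
  The component on an edge \<open>e\<close> incident on \<open>v\<close>, in the local coordinate in which \<open>v\<close>
  corresponds to \<open>0\<close>.
\<close>

definition local_component ::
    "('v, 'e) pre_digraph \<Rightarrow> 'e qg_fun \<Rightarrow> 'v \<Rightarrow> 'e \<Rightarrow> real \<Rightarrow> complex" where
  "local_component G f v e = (if tail G e = v then f e else (\<lambda>x. f e (1 - x)))"

definition continuous_at_vertices :: "('v, 'e) pre_digraph \<Rightarrow> 'e qg_fun \<Rightarrow> bool" where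
  "continuous_at_vertices G f \<longleftrightarrow>
     (\<forall>v\<in>verts G. \<forall>e\<in>incident_edges G v. \<forall>e'\<in>incident_edges G v.
        local_component G f v e 0 = local_component G f v e' 0)"

definition kirchhoff :: "('v, 'e) pre_digraph \<Rightarrow> 'e qg_fun \<Rightarrow> bool" where
  "kirchhoff G f \<longleftrightarrow>
     (\<forall>v\<in>verts G. (\<Sum>e\<in>incident_edges G v. edge_deriv (local_component G f v e) 0) = 0)"

definition laplacian_domain :: "('v, 'e) pre_digraph \<Rightarrow> 'e qg_fun set" where
  "laplacian_domain G =
     {f. (\<forall>e\<in>arcs G. f e \<in> H2_unit) \<and> continuous_at_vertices G f \<and> kirchhoff G f}"

text \<open>
  For \<open>f e \<in> H2_unit\<close> the second derivative exists almost everywhere on \<open>[0,1]\<close>; accordingly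
  equations involving \<open>laplacian f\<close> are understood almost everywhere.
\<close>

definition laplacian :: "'e qg_fun \<Rightarrow> 'e qg_fun" where
  "laplacian f e x = - edge_deriv (edge_deriv (f e)) x"

definition laplacian_eigenfunction ::
    "('v, 'e) pre_digraph \<Rightarrow> complex \<Rightarrow> 'e qg_fun \<Rightarrow> bool" where
  "laplacian_eigenfunction G l f \<longleftrightarrow>
     f \<in> laplacian_domain G \<and>
     \<not> (\<forall>e\<in>arcs G. AE x in lebesgue_on {0..1}. f e x = 0) \<and>
     (\<forall>e\<in>arcs G. AE x in lebesgue_on {0..1}. laplacian f e x = l * f e x)"

end

theory Submission
  imports Defs
begin

text \<open>
  On an edge, \<open>\<omega>\<^sup>2 y\<^sub>1 cnj y\<^sub>2 + y\<^sub>1' cnj y\<^sub>2'\<close> is the constant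
  \<open>\<omega>\<^sup>2 (A\<^sub>1 cnj A\<^sub>2 + B\<^sub>1 cnj B\<^sub>2)\<close>, while \<open>(y\<^sub>1' cnj y\<^sub>2)' = - \<omega>\<^sup>2 y\<^sub>1 cnj y\<^sub>2 + y\<^sub>1' cnj y\<^sub>2'\<close>.
  Subtracting and integrating gives the claimed edge term up to the boundary term
  \<open>[y\<^sub>1' cnj y\<^sub>2]\<^sub>0\<^sup>1 / (2 \<omega>\<^sup>2)\<close>. Regrouped by vertices, the boundary terms cancel, since \<open>y\<^sub>2\<close> is
  continuous at each vertex and \<open>y\<^sub>1\<close> satisfies the Kirchhoff condition.
\<close>

text \<open>Keeping the coefficients as parameters turns differentiation into the linear map
  \<open>(a, b)\<close> to \<open>(w * b, - (w * a))\<close>, so all derivatives stay in the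
  family.\<close>

definition trig_wave :: "real \<Rightarrow> complex \<Rightarrow> complex \<Rightarrow> real \<Rightarrow> complex" where
  "trig_wave w a b x = a * complex_of_real (cos (w * x)) + b * complex_of_real (sin (w * x))"

lemma trig_wave_has_vector_derivative:
  "(trig_wave w a b has_vector_derivative trig_wave w (w * b) (- (w * a)) x) (at x within S)"
proof -
  have "((\<lambda>x. cos (w * x)) has_real_derivative - (w * sin (w * x))) (at x within S)"
    "((\<lambda>x. sin (w * x)) has_real_derivative w * cos (w * x)) (at x within S)"
    by (auto intro!: derivative_eq_intros)
  from this[THEN has_vector_derivative_of_real]
  have "((\<lambda>x. a * complex_of_real (cos (w * x)) + b * complex_of_real (sin (w * x)))
      has_vector_derivative a * complex_of_real (- (w * sin (w * x)))
        + b * complex_of_real (w * cos (w * x))) (at x within S)"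
    by (intro has_vector_derivative_add has_vector_derivative_mult_right)
  then show ?thesis
    by (simp add: trig_wave_def[abs_def] algebra_simps)
qed

text \<open>\<open>(trig_wave w a b x, trig_wave w b (- a) x)\<close> is the vector
  \<open>(a, b)\<close> rotated by the angle \<open>- w * x\<close>, and a real rotation preserves
  the Hermitian inner product.\<close>

lemma trig_wave_energy:
  "trig_wave w a b x * cnj (trig_wave w c d x) + trig_wave w b (- a) x * cnj (trig_wave w d (- c) x)
     = a * cnj c + b * cnj d"
proof -
  define C where "C = complex_of_real (cos (w * x))"
  define S where "S = complex_of_real (sin (w * x))"
  have "C * C + S * S = 1"
    unfolding C_def S_def
    by (simp flip: of_real_mult of_real_add add: sin_cos_squared_add3)
  moreover have "trig_wave w a b x * cnj (trig_wave w c d x)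
      + trig_wave w b (- a) x * cnj (trig_wave w d (- c) x)
      = (a * cnj c + b * cnj d) * (C * C + S * S)"
    by (simp add: trig_wave_def C_def S_def algebra_simps)
  ultimately show ?thesis by simp
qed

lemma lebesgue_integral_trig_wave_mult_cnj:
  fixes w :: real and a b c d :: complex
  assumes "w \<noteq> 0"
  defines "u \<equiv> trig_wave w a b" and "v \<equiv> trig_wave w c d"
    and "u' \<equiv> trig_wave w (w * b) (- (w * a))"
  shows "(LINT x|lebesgue_on {0..1}. u x * cnj (v x))
    = 1/2 * (a * cnj c + b * cnj d) - (u' 1 * cnj (v 1) - u' 0 * cnj (v 0)) / (2 * w\<^sup>2)"
proof -
  \<comment> \<open>With \<open>K = a * cnj c + b * cnj d\<close>, the energy identity gives
    \<open>K / 2 - (u' * cnj v)' / (2 * w\<^sup>2) = K / 2 - (K - 2 * u * cnj v) / 2\<close>. The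
    constants cancel, so \<open>F\<close> is an explicit antiderivative of
    \<open>u * cnj v\<close>.\<close>
  define F where "F x = x * (1/2 * (a * cnj c + b * cnj d)) - u' x * cnj (v x) / (2 * w\<^sup>2)" for x :: real
  define v' where "v' = trig_wave w (w * d) (- (w * c))"
  have u'': "(u' has_vector_derivative - (w\<^sup>2 * u x)) (at x within S)" for x S
  proof -
    have "trig_wave w (w * - (w * a)) (- (w * (w * b))) x = - (w\<^sup>2 * u x)"
      by (simp add: u_def trig_wave_def power2_eq_square algebra_simps)
    then show ?thesis
      using trig_wave_has_vector_derivative[of w "w * b" "- (w * a)" x S] by (simp add: u'_def)
  qed
  have v': "((\<lambda>x. cnj (v x)) has_vector_derivative cnj (v' x)) (at x within S)" for x S
    unfolding v_def v'_def by (intro derivative_intros trig_wave_has_vector_derivative)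
  have energy: "u' x * cnj (v' x) = w\<^sup>2 * (a * cnj c + b * cnj d - u x * cnj (v x))" for x
  proof -
    have "u' x = w * trig_wave w b (- a) x" "v' x = w * trig_wave w d (- c) x"
      by (simp_all add: u'_def v'_def trig_wave_def algebra_simps)
    then have "u' x * cnj (v' x) = w\<^sup>2 * (trig_wave w b (- a) x * cnj (trig_wave w d (- c) x))"
      by (simp add: power2_eq_square)
    moreover have "trig_wave w b (- a) x * cnj (trig_wave w d (- c) x)
        = a * cnj c + b * cnj d - u x * cnj (v x)"
      using trig_wave_energy[of w a b x c d] by (simp add: u_def v_def algebra_simps)
    ultimately show ?thesis by simp
  qed
  have F': "(F has_vector_derivative u x * cnj (v x)) (at x within S)" for x S
  proof -
    have x: "((\<lambda>x. complex_of_real x * k) has_vector_derivative k) (at x within S)" for k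
      using has_vector_derivative_mult_left[OF has_vector_derivative_of_real[OF DERIV_ident]]
      by fastforce
    have "(F has_vector_derivative 1/2 * (a * cnj c + b * cnj d)
        - (u' x * cnj (v' x) + - (w\<^sup>2 * u x) * cnj (v x)) / (2 * w\<^sup>2)) (at x within S)"
      unfolding F_def[abs_def]
      by (intro has_vector_derivative_diff has_vector_derivative_divide
          has_vector_derivative_mult u'' v' x)
    moreover have "1/2 * (a * cnj c + b * cnj d)
        - (u' x * cnj (v' x) + - (w\<^sup>2 * u x) * cnj (v x)) / (2 * w\<^sup>2) = u x * cnj (v x)"
      unfolding energy using assms(1) by (simp add: field_simps)
    ultimately show ?thesis by simp
  qed
  have "continuous_on {0..1} (\<lambda>x. u x * cnj (v x))"
    unfolding u_def v_def trig_wave_def by (intro continuous_intros)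
  then have "(LINT x|lebesgue_on {0..1}. u x * cnj (v x)) = integral {0..1} (\<lambda>x. u x * cnj (v x))"
    by (intro lebesgue_integral_eq_integral continuous_imp_integrable_real) auto
  also have "\<dots> = F 1 - F 0"
    by (intro integral_unique fundamental_theorem_of_calculus F') auto
  finally show ?thesis
    by (simp add: F_def diff_divide_distrib)
qed

text \<open>Derivatives within a nondegenerate interval are unique even at its end points, and they
  depend only on the values on that interval.\<close>

lemma edge_deriv_eq:
  assumes "x \<in> {0..1}" "\<And>t. t \<in> {0..1} \<Longrightarrow> f t = g t"
    and "(g has_vector_derivative d) (at x within {0..1})"
  shows "edge_deriv f x = d"
proof -
  have "(f has_vector_derivative d) (at x within {0..1})"
    using has_vector_derivative_transform[OF assms(1) _ assms(3)] assms(2) by auto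
  then show ?thesis
    unfolding edge_deriv_def
    using vector_derivative_within_cbox[of 0 1 x f d] assms(1) by simp
qed

text \<open>Double counting of incidences: since there are no loops, the two end points of an arc
  are distinct and contribute one term each.\<close>

lemma sum_incident_edges:
  fixes g :: "'v \<Rightarrow> 'e \<Rightarrow> 'a::comm_monoid_add"
  assumes "digraph G"
  shows "(\<Sum>v\<in>verts G. \<Sum>e\<in>incident_edges G v. g v e)
    = (\<Sum>e\<in>arcs G. g (tail G e) e + g (head G e) e)"
proof -
  interpret digraph G by fact
  have "(\<Sum>v\<in>verts G. \<Sum>e\<in>incident_edges G v. g v e)
      = (\<Sum>e\<in>arcs G. \<Sum>v\<in>{v \<in> verts G. tail G e = v \<or> head G e = v}. g v e)"
    unfolding incident_edges_def
    by (rule sum.swap_restrict) auto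
  also have "\<dots> = (\<Sum>e\<in>arcs G. g (tail G e) e + g (head G e) e)"
  proof (rule sum.cong[OF refl])
    fix e assume e: "e \<in> arcs G"
    then have "{v \<in> verts G. tail G e = v \<or> head G e = v} = {tail G e, head G e}"
      by auto
    then show "(\<Sum>v\<in>{v \<in> verts G. tail G e = v \<or> head G e = v}. g v e)
        = g (tail G e) e + g (head G e) e"
      using no_loops[OF e] by simp
  qed
  finally show ?thesis .
qed

lemma kirchhoff_continuous_boundary_sum:
  assumes "digraph G" "kirchhoff G f" "continuous_at_vertices G h"
  shows "(\<Sum>e\<in>arcs G. edge_deriv (f e) 0 * cnj (h e 0)
    + edge_deriv (\<lambda>x. f e (1 - x)) 0 * cnj (h e 1)) = 0"
proof -
  interpret digraph G by fact
  let ?g = "\<lambda>v e. edge_deriv (local_component G f v e) 0 * cnj (local_component G h v e 0)"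
  have "(\<Sum>e\<in>arcs G. edge_deriv (f e) 0 * cnj (h e 0)
      + edge_deriv (\<lambda>x. f e (1 - x)) 0 * cnj (h e 1))
      = (\<Sum>e\<in>arcs G. ?g (tail G e) e + ?g (head G e) e)"
    \<comment> \<open>\<open>local_component\<close> tests the tail first; at the head it yields the
      reversed component because head and tail differ.\<close>
    by (rule sum.cong) (simp_all add: local_component_def no_loops)
  also have "\<dots> = (\<Sum>v\<in>verts G. \<Sum>e\<in>incident_edges G v. ?g v e)"
    using sum_incident_edges[OF assms(1), of ?g] by simp
  also have "\<dots> = 0"
  proof (rule sum.neutral, rule ballI)
    fix v assume v: "v \<in> verts G"
    \<comment> \<open>\<open>c\<close> is the common value of \<open>h\<close> at \<open>v\<close>,
      read off any incident edge; if there is none, any \<open>c\<close> works. It factors out of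
      the sum, leaving the Kirchhoff sum of \<open>f\<close>.\<close>
    obtain c where "\<forall>e\<in>incident_edges G v. local_component G h v e 0 = c"
    proof (cases "incident_edges G v = {}")
      case False
      then obtain e' where "e' \<in> incident_edges G v" by auto
      with assms(3) v
      have "\<forall>e\<in>incident_edges G v. local_component G h v e 0 = local_component G h v e' 0"
        unfolding continuous_at_vertices_def by blast
      then show thesis by (rule that)
    qed (rule that, simp)
    then have "(\<Sum>e\<in>incident_edges G v. ?g v e)
        = (\<Sum>e\<in>incident_edges G v. edge_deriv (local_component G f v e) 0) * cnj c"
      by (simp add: sum_distrib_right)
    then show "(\<Sum>e\<in>incident_edges G v. ?g v e) = 0"
      using assms(2) v by (simp add: kirchhoff_def)
  qed
  finally show ?thesis .
qed

theorem theorem4p4: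
  fixes G :: "('v, 'e) pre_digraph"
    and y1 y2 :: "'e qg_fun"
    and A1 B1 A2 B2 :: "'e \<Rightarrow> complex"
    and l \<omega> :: real
  assumes "oriented_simple_graph G"
    and "Digraph_Component.connected G"
    and "\<And>v. v \<in> verts G \<Longrightarrow> vertex_degree G v \<ge> 2"
    and "l > 0"
    and "\<omega> = sqrt l"
    and "laplacian_eigenfunction G (complex_of_real l) y1"
    and "laplacian_eigenfunction G (complex_of_real l) y2"
    and "\<And>e x. e \<in> arcs G \<Longrightarrow> x \<in> {0..1} \<Longrightarrow>
           y1 e x = A1 e * complex_of_real (cos (\<omega> * x)) + B1 e * complex_of_real (sin (\<omega> * x))"
    and "\<And>e x. e \<in> arcs G \<Longrightarrow> x \<in> {0..1} \<Longrightarrow>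
           y2 e x = A2 e * complex_of_real (cos (\<omega> * x)) + B2 e * complex_of_real (sin (\<omega> * x))"
  shows "qg_inner G y1 y2 = (\<Sum>e\<in>arcs G. 1/2 * (A1 e * cnj (A2 e) + B1 e * cnj (B2 e)))"
proof -
  define u where "u e = trig_wave \<omega> (A1 e) (B1 e)" for e
  define v where "v e = trig_wave \<omega> (A2 e) (B2 e)" for e
  define u' where "u' e = trig_wave \<omega> (\<omega> * B1 e) (- (\<omega> * A1 e))" for e
  define bdry where "bdry e = u' e 1 * cnj (v e 1) - u' e 0 * cnj (v e 0)" for e
  have y1: "y1 e x = u e x" and y2: "y2 e x = v e x" if "e \<in> arcs G" "x \<in> {0..1}" for e x
    using assms(8,9) that by (auto simp: u_def v_def trig_wave_def)
  have u': "(u e has_vector_derivative u' e x) (at x within S)" for e x S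
    unfolding u_def u'_def by (rule trig_wave_has_vector_derivative)
  have "\<omega> \<noteq> 0" using assms(4,5) by simp
  have dg: "digraph G" using assms(1) by (simp add: oriented_simple_graph_def)
  \<comment> \<open>Derivatives pointing into the edge are \<open>u' e 0\<close> at the tail and,
    after the reflection, \<open>- u' e 1\<close> at the head; hence the minus sign.\<close>
  have "edge_deriv (y1 e) 0 * cnj (y2 e 0) + edge_deriv (\<lambda>x. y1 e (1 - x)) 0 * cnj (y2 e 1)
      = - bdry e" if e: "e \<in> arcs G" for e
  proof -
    have "edge_deriv (y1 e) 0 = u' e 0"
      by (rule edge_deriv_eq[OF _ y1[OF e] u']) auto
    moreover have "edge_deriv (\<lambda>x. y1 e (1 - x)) 0 = - u' e 1"
    proof (rule edge_deriv_eq)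
      have "((\<lambda>x::real. 1 - x) has_vector_derivative -1) (at 0 within {0..1})"
        by (auto intro!: derivative_eq_intros)
      from vector_diff_chain_within[OF this u']
      show "((\<lambda>x. u e (1 - x)) has_vector_derivative - u' e 1) (at 0 within {0..1})"
        by (simp add: o_def)
    qed (auto simp: y1[OF e])
    ultimately show ?thesis
      by (simp add: y2[OF e] bdry_def)
  qed
  moreover have "kirchhoff G y1" "continuous_at_vertices G y2"
    using assms(6,7) by (auto simp: laplacian_eigenfunction_def laplacian_domain_def)
  ultimately have "(\<Sum>e\<in>arcs G. bdry e) = 0"
    using kirchhoff_continuous_boundary_sum[OF dg, of y1 y2] by (simp add: sum_negf)
  moreover have "qg_inner G y1 y2
      = (\<Sum>e\<in>arcs G. 1/2 * (A1 e * cnj (A2 e) + B1 e * cnj (B2 e)) - bdry e / (2 * \<omega>\<^sup>2))"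
    unfolding qg_inner_def
  proof (rule sum.cong[OF refl])
    fix e assume e: "e \<in> arcs G"
    have "(LINT x|lebesgue_on {0..1}. y1 e x * cnj (y2 e x))
        = (LINT x|lebesgue_on {0..1}. u e x * cnj (v e x))"
      by (rule Bochner_Integration.integral_cong) (auto simp: y1[OF e] y2[OF e])
    also have "\<dots> = 1/2 * (A1 e * cnj (A2 e) + B1 e * cnj (B2 e)) - bdry e / (2 * \<omega>\<^sup>2)"
      unfolding u_def v_def bdry_def u'_def
      by (rule lebesgue_integral_trig_wave_mult_cnj) fact
    finally show "(LINT x|lebesgue_on {0..1}. y1 e x * cnj (y2 e x))
        = 1/2 * (A1 e * cnj (A2 e) + B1 e * cnj (B2 e)) - bdry e / (2 * \<omega>\<^sup>2)" .
  qed
  \<comment> \<open>The factor \<open>1 / (2 * \<omega>\<^sup>2)\<close> is the same on every edge,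
    so the vanishing of the total of \<open>bdry\<close> suffices, although single terms may be
    nonzero.\<close>
  ultimately show ?thesis
    by (simp only: sum_subtractf sum_divide_distrib[symmetric]) simp
qed

end
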